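(* Let $f(s)=\sum_i\frac{a_i}{i^s}$ be a Dirichlet polynomial of composite degree $n$ with integer coefficients, let $p$ be the least prime factor of $n$, and suppose $f$ has $k\ge1$ relevant primes. If $|f(-t)|=Pq$ with $P$ a prime number, $q$ a positive integer, and $t$ an integer satisfying $$t>\frac np\log\left(\frac{nqH(f)}{p}\cdot\left(\frac n2\right)^{k\left(1+\frac{\log_3(\log_2 12)}{2}\right)}\right),$$ then $f$ is irreducible (it is not a product of two nonconstant Dirichlet polynomials with integer coefficients).
   Context: Dirichlet polynomials are multiplied by the Dirichlet product $\left(\sum_j\frac{b_j}{j^s}\right)\left(\sum_k\frac{c_k}{k^s}\right)=\sum_i\frac{\sum_{jk=i}b_jc_k}{i^s}$; constant means supported on $\{1\}$. The degree of $f$ is the largest $i$ with $a_i\ne0$. $f(-t)=\sum_i a_i i^t$. $H(f)=\max_i|a_i|$. The relevant primes of $f$ are the primes dividing at least one index $i$ with $a_i\neq0$. $\log$ is the natural logarithm. *)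

theory Defs
  imports Complex_Main "HOL-Computational_Algebra.Primes"
begin

text \<open>A Dirichlet polynomial with integer coefficients, the sum of \<open>a\<^sub>i / i\<^sup>s\<close> over
  \<open>i \<ge> 1\<close>, is represented by its coefficient function \<open>a\<close>; the index \<open>0\<close>, which does
  not occur in the sum, carries the coefficient \<open>0\<close>.\<close>

definition dirichlet_poly :: "(nat \<Rightarrow> int) \<Rightarrow> bool" where
  "dirichlet_poly f \<longleftrightarrow> f 0 = 0 \<and> finite {i. f i \<noteq> 0}"

text \<open>At \<open>i = 0\<close> the index set is infinite, so the sum is \<open>0\<close> there by convention.\<close>

definition dirichlet_mult :: "(nat \<Rightarrow> int) \<Rightarrow> (nat \<Rightarrow> int) \<Rightarrow> nat \<Rightarrow> int" where
  "dirichlet_mult g h i = (\<Sum>(j, k)\<in>{(j, k). j * k = i}. g j * h k)"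

definition dp_constant :: "(nat \<Rightarrow> int) \<Rightarrow> bool" where
  "dp_constant f \<longleftrightarrow> {i. f i \<noteq> 0} \<subseteq> {1}"

text \<open>Degree and height are meaningful only for nonzero \<open>f\<close> (\<open>Max {}\<close> is unspecified).\<close>

definition dp_degree :: "(nat \<Rightarrow> int) \<Rightarrow> nat" where
  "dp_degree f = Max {i. f i \<noteq> 0}"

definition dp_height :: "(nat \<Rightarrow> int) \<Rightarrow> int" where
  "dp_height f = Max ((\<lambda>i. \<bar>f i\<bar>) ` {i. f i \<noteq> 0})"

definition dp_eval :: "(nat \<Rightarrow> int) \<Rightarrow> real \<Rightarrow> real" where
  "dp_eval f s = (\<Sum>i | f i \<noteq> 0. real_of_int (f i) / real i powr s)"

definition relevant_primes :: "(nat \<Rightarrow> int) \<Rightarrow> nat set" where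
  "relevant_primes f = {r. prime r \<and> (\<exists>i. f i \<noteq> 0 \<and> r dvd i)}"

text \<open>Only factorizations into two nonconstant factors are excluded: a nonunit integer
  constant may be a factor, unlike for \<open>irreducible\<close> in the ring.\<close>

definition dp_irreducible :: "(nat \<Rightarrow> int) \<Rightarrow> bool" where
  "dp_irreducible f \<longleftrightarrow>
     \<not> (\<exists>g h. dirichlet_poly g \<and> dirichlet_poly h \<and>
            \<not> dp_constant g \<and> \<not> dp_constant h \<and> f = dirichlet_mult g h)"

end

theory Submission
  imports Defs "HOL-Library.FuncSet"
begin

text \<open>Suppose \<open>f = g * h\<close>. A Dirichlet polynomial is a polynomial with one variable per relevant
  prime; adding a second variable per prime makes it multihomogeneous. Bombieri's
  inequality for the Fischer norm then bounds the product of any two coefficients of \<open>g\<close> and \<open>h\<close> by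
  the norm of \<open>f\<close>, and since \<open>r\<close>-degrees are at most \<open>log 2 n\<close> for each prime \<open>r\<close>, the height of
  \<open>g\<close> is at most \<open>H(f) (n/2) powr (3k/2)\<close>. Because \<open>log 3 (log 2 12) \<ge> 1\<close>, the lower bound on \<open>t\<close>
  therefore makes the leading term of \<open>g(-t)\<close> dominate the others, so that \<open>|g(-t)| > q\<close>, and
  likewise \<open>|h(-t)| > q\<close>. But the prime \<open>P\<close> divides one of these two integers, so the other one
  is at most \<open>q\<close> in absolute value.\<close>

section \<open>Bombieri's inequality\<close>

definition mset_fact :: "'a multiset \<Rightarrow> nat" where
  "mset_fact a = (\<Prod>x\<in>set_mset a. fact (count a x))"

text \<open>The product runs over the union so that an element of \<open>u\<close> missing from
  \<open>a\<close> contributes a zero binomial; over \<open>a\<close> alone,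
  \<open>mset_choose_eq_0\<close> would fail.\<close>

definition mset_choose :: "'a multiset \<Rightarrow> 'a multiset \<Rightarrow> nat" where
  "mset_choose a u = (\<Prod>x\<in>set_mset a \<union> set_mset u. count a x choose count u x)"

lemma mset_fact_superset:
  assumes "finite V" "set_mset a \<subseteq> V"
  shows "mset_fact a = (\<Prod>x\<in>V. fact (count a x))"
  unfolding mset_fact_def using assms
  by (intro prod.mono_neutral_left) (auto simp: not_in_iff)

lemma mset_fact_pos: "mset_fact a > 0"
  by (simp add: mset_fact_def prod_pos)

lemma mset_choose_superset:
  assumes "finite V" "set_mset a \<subseteq> V" "set_mset u \<subseteq> V"
  shows "mset_choose a u = (\<Prod>x\<in>V. count a x choose count u x)"
  unfolding mset_choose_def using assms
  by (intro prod.mono_neutral_left) (auto simp: not_in_iff)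

lemma mset_choose_eq_0:
  assumes "\<not> u \<subseteq># a"
  shows "mset_choose a u = 0"
proof -
  obtain x where x: "count a x < count u x"
    using assms by (auto simp: subseteq_mset_def not_le)
  then have "x \<in># u" by (simp flip: count_greater_zero_iff)
  with x show ?thesis
    unfolding mset_choose_def by (intro prod_zero) (auto intro!: bexI[of _ x])
qed

lemma mset_choose_fact:
  assumes "u \<subseteq># a"
  shows "mset_fact u * mset_fact (a - u) * mset_choose a u = mset_fact a"
proof -
  let ?V = "set_mset a"
  have "set_mset u \<subseteq> ?V" "set_mset (a - u) \<subseteq> ?V"
    using assms by (auto dest: mset_subset_eqD in_diffD)
  moreover have "count u x \<le> count a x" for x
    using assms by (simp add: subseteq_mset_def)
  ultimately show ?thesis
    by (simp add: mset_fact_superset[of ?V] mset_choose_superset[of ?V] binomial_fact_lemma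
        flip: prod.distrib)
qed

text \<open>Pascal's rule for the binomial at \<open>x\<close>; the binomials at all other elements
  are shared by the three terms and collected in \<open>Q\<close>.\<close>

lemma mset_choose_add_mset:
  "mset_choose (add_mset x a) u =
     mset_choose a u + (if x \<in># u then mset_choose a (u - {#x#}) else 0)"
proof -
  let ?V = "insert x (set_mset a \<union> set_mset u)"
  have split: "mset_choose b w =
      (count b x choose count w x) * (\<Prod>y\<in>?V - {x}. count b y choose count w y)"
    if "set_mset b \<subseteq> ?V" "set_mset w \<subseteq> ?V" for b w
    using that by (subst mset_choose_superset[of ?V]) (auto simp: prod.remove[of ?V x])
  define Q where "Q = (\<Prod>y\<in>?V - {x}. count a y choose count u y)"
  have Q: "(\<Prod>y\<in>?V - {x}. count b y choose count w y) = Q"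
    if "\<And>y. y \<noteq> x \<Longrightarrow> count b y = count a y" "\<And>y. y \<noteq> x \<Longrightarrow> count w y = count u y" for b w
    unfolding Q_def by (rule prod.cong) (use that in auto)
  have sub: "set_mset (add_mset x a) \<subseteq> ?V" "set_mset a \<subseteq> ?V" "set_mset u \<subseteq> ?V"
    "set_mset (u - {#x#}) \<subseteq> ?V"
    by (auto dest: in_diffD)
  have "mset_choose (add_mset x a) u = (count (add_mset x a) x choose count u x) * Q"
    unfolding split[OF sub(1,3)] by (subst Q) auto
  moreover have "mset_choose a u = (count a x choose count u x) * Q"
    unfolding split[OF sub(2,3)] by (subst Q) auto
  moreover have "mset_choose a (u - {#x#}) = (count a x choose count (u - {#x#}) x) * Q"
    unfolding split[OF sub(2,4)] by (subst Q) auto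
  ultimately have eqs: "mset_choose (add_mset x a) u = (Suc (count a x) choose count u x) * Q"
    "mset_choose a u = (count a x choose count u x) * Q"
    "mset_choose a (u - {#x#}) = (count a x choose (count u x - 1)) * Q"
    by simp_all
  show ?thesis
  proof (cases "x \<in># u")
    case True
    then obtain j where "count u x = Suc j"
      by (metis not_in_iff not0_implies_Suc)
    with True show ?thesis
      by (simp add: eqs algebra_simps)
  next
    case False
    then have "count u x = 0" by (simp add: not_in_iff)
    with False show ?thesis by (simp add: eqs)
  qed
qed

lemma finite_subsets_mset: "finite {u. u \<subseteq># c}"
proof (rule finite_subset)
  show "{u. u \<subseteq># c} \<subseteq> {u. set_mset u \<subseteq> set_mset c \<and> size u \<le> size c}"
    by (auto dest: mset_subset_eqD size_mset_mono)
  show "finite {u. set_mset u \<subseteq> set_mset c \<and> size u \<le> size c}"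
  proof (rule finite_subset)
    show "{u. set_mset u \<subseteq> set_mset c \<and> size u \<le> size c} \<subseteq>
        mset ` {xs. set xs \<subseteq> set_mset c \<and> length xs \<le> size c}"
    proof
      fix u assume u: "u \<in> {u. set_mset u \<subseteq> set_mset c \<and> size u \<le> size c}"
      obtain xs where "mset xs = u" using ex_mset by blast
      with u show "u \<in> mset ` {xs. set xs \<subseteq> set_mset c \<and> length xs \<le> size c}"
        by (auto intro!: image_eqI[of _ _ xs])
    qed
  qed (simp add: finite_lists_length_le)
qed

text \<open>Induction on \<open>a\<close>: both sides obey the recurrence of
  \<open>mset_choose_add_mset\<close> when \<open>x\<close> is added.\<close>

lemma vandermonde_mset:
  "(\<Sum>u | u \<subseteq># c. mset_choose a u * mset_choose b (c - u)) = mset_choose (a + b) c"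
proof (induction a arbitrary: c)
  case empty
  have "(\<Sum>u | u \<subseteq># c. mset_choose {#} u * mset_choose b (c - u)) =
      (\<Sum>u\<in>{{#}}. mset_choose {#} u * mset_choose b (c - u))"
    by (rule sum.mono_neutral_right) (auto simp: finite_subsets_mset mset_choose_eq_0)
  then show ?case
    by (simp add: mset_choose_def)
next
  case (add x a)
  let ?T = "\<lambda>c. \<Sum>u | u \<subseteq># c. mset_choose a u * mset_choose b (c - u)"
  have "(\<Sum>u | u \<subseteq># c. mset_choose (add_mset x a) u * mset_choose b (c - u)) =
      ?T c + (\<Sum>u | u \<subseteq># c.
        (if x \<in># u then mset_choose a (u - {#x#}) * mset_choose b (c - u) else 0))"
    unfolding sum.distrib[symmetric]
    by (rule sum.cong) (auto simp: mset_choose_add_mset algebra_simps)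
  also have "(\<Sum>u | u \<subseteq># c.
        (if x \<in># u then mset_choose a (u - {#x#}) * mset_choose b (c - u) else 0)) =
      (if x \<in># c then ?T (c - {#x#}) else 0)"
  proof (cases "x \<in># c")
    case True
    have "(\<Sum>u | u \<subseteq># c.
        (if x \<in># u then mset_choose a (u - {#x#}) * mset_choose b (c - u) else 0)) =
        (\<Sum>u\<in>{u. u \<subseteq># c \<and> x \<in># u}. mset_choose a (u - {#x#}) * mset_choose b (c - u))"
      by (rule sum.mono_neutral_cong_right) (auto simp: finite_subsets_mset)
    \<comment> \<open>Removing one \<open>x\<close> from both \<open>u\<close> and \<open>c\<close>
      leaves \<open>c - u\<close> unchanged.\<close>
    also have "\<dots> = ?T (c - {#x#})"
      using True
      by (intro sum.reindex_bij_witness[of _ "add_mset x" "\<lambda>u. u - {#x#}"])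
        (auto simp: insert_subset_eq_iff subset_eq_diff_conv)
    finally show ?thesis using True by simp
  next
    case False
    then show ?thesis
      by (auto intro!: sum.neutral dest: mset_subset_eqD)
  qed
  also have "?T c + (if x \<in># c then ?T (c - {#x#}) else 0) = mset_choose (add_mset x a + b) c"
    by (simp add: add.IH mset_choose_add_mset del: diff_diff_add_mset)
  finally show ?case .
qed

text \<open>The quadruple \<open>(u, v, m, m')\<close> is a two-by-two contingency table with row sums \<open>a\<close>, \<open>b\<close>
  and column sums \<open>c\<close>, \<open>d\<close>.\<close>

lemma mset_fact_contingency:
  assumes "a + b = c + d"
  shows "real (mset_fact (a + b)) =
    (\<Sum>(u, v, m, m') | u + m = a \<and> v + m' = b \<and> u + m' = c \<and> v + m = d.
       real (mset_fact a * mset_fact b * mset_fact c * mset_fact d) /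
       real (mset_fact u * mset_fact v * mset_fact m * mset_fact m'))"
proof -
  \<comment> \<open>The corner \<open>u\<close> determines the table; the three inclusions say that
    the remaining entries \<open>c - u\<close>, \<open>a - u\<close> and \<open>b - (c - u)\<close>
    are genuine differences.\<close>
  let ?U = "{u. u \<subseteq># c \<and> u \<subseteq># a \<and> c - u \<subseteq># b}"
  let ?F = "\<lambda>a. real (mset_fact a)"
  have choose: "real (mset_choose a u) = ?F a / (?F u * ?F (a - u))" if "u \<subseteq># a" for a u :: "'a multiset"
    using mset_fact_pos[of u] mset_fact_pos[of "a - u"]
    by (simp flip: mset_choose_fact[OF that])
  have "?F (a + b) = ?F c * ?F d * mset_choose (a + b) c"
    using mset_choose_fact[of c "a + b"] assms by (simp flip: of_nat_mult)
  also have "real (mset_choose (a + b) c) = (\<Sum>u | u \<subseteq># c. real (mset_choose a u * mset_choose b (c - u)))"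
    by (simp flip: vandermonde_mset)
  also have "\<dots> = (\<Sum>u\<in>?U. real (mset_choose a u * mset_choose b (c - u)))"
    using mset_choose_eq_0
    by (intro sum.mono_neutral_right) (force simp: finite_subsets_mset)+
  also have "?F c * ?F d * \<dots> = (\<Sum>u\<in>?U. ?F a * ?F b * ?F c * ?F d /
      (?F u * ?F (b - (c - u)) * ?F (a - u) * ?F (c - u)))"
    unfolding sum_distrib_left
  proof (rule sum.cong[OF refl])
    fix u assume "u \<in> ?U"
    moreover have "C * D * (A / (U * M) * (B / (M' * V))) = A * B * C * D / (U * V * M * M')"
      for A B C D U V M M' :: real
      by (simp add: field_simps)
    ultimately show "?F c * ?F d * real (mset_choose a u * mset_choose b (c - u)) =
        ?F a * ?F b * ?F c * ?F d / (?F u * ?F (b - (c - u)) * ?F (a - u) * ?F (c - u))"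
      by (simp only: of_nat_mult choose mem_Collect_eq)
  qed
  also have "\<dots> = (\<Sum>(u, v, m, m') | u + m = a \<and> v + m' = b \<and> u + m' = c \<and> v + m = d.
       ?F a * ?F b * ?F c * ?F d / (?F u * ?F v * ?F m * ?F m'))"
  proof (rule sum.reindex_bij_witness[of _ fst "\<lambda>u. (u, b - (c - u), a - u, c - u)"], goal_cases)
    case (2 u)
    then obtain m m' v where "a = u + m" "c = u + m'" "b = m' + v"
      by (auto simp: mset_subset_eq_exists_conv)
    moreover from this assms have "d = v + m"
      by (simp add: ac_simps)
    ultimately show ?case by (simp add: ac_simps)
  qed auto
  finally show ?thesis by simp
qed

text \<open>A multiset is the exponent vector of a monomial, and \<open>mset_fact\<close> its weight in the Fischer norm.
  Expanding the weights by contingency tables and regrouping turns the right-hand side into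
  the sum over \<open>u\<close>, \<open>v\<close> of the squares \<open>(R u v)\<^sup>2\<close>, divided by the weights of \<open>u\<close> and \<open>v\<close>. If \<open>u\<close> is a
  monomial of the homogeneous factor \<open>p\<close>, only the term \<open>m = {#}\<close> of \<open>R u v\<close> survives; the
  left-hand side is the sum over these \<open>u\<close>.\<close>

lemma bombieri_inequality:
  fixes p q :: "'v multiset \<Rightarrow> real"
  assumes fin: "finite A" "finite B" and hom: "\<And>a. a \<in> A \<Longrightarrow> size a = e"
  shows "(\<Sum>(a, b)\<in>A \<times> B. real (mset_fact a * mset_fact b) * (p a * q b)\<^sup>2) \<le>
    (\<Sum>s\<in>(\<lambda>(a, b). a + b) ` (A \<times> B). real (mset_fact s) *
       (\<Sum>(a, b)\<in>{(a, b). a \<in> A \<and> b \<in> B \<and> a + b = s}. p a * q b)\<^sup>2)"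
proof -
  let ?F = "\<lambda>a. real (mset_fact a)"
  let ?N = "(\<lambda>(a, b). a + b) ` (A \<times> B)"
  \<comment> \<open>Weighted coefficients are extended by zero, so that all sums can range over the
    one finite set \<open>S\<close> of divisors of monomials in \<open>A\<close> and
    \<open>B\<close>.\<close>
  define w where "w a = (if a \<in> A then ?F a * p a else 0)" for a
  define z where "z b = (if b \<in> B then ?F b * q b else 0)" for b
  define S where "S = (\<Union>x\<in>A \<union> B. {u. u \<subseteq># x})"
  define R where "R u v = (\<Sum>m\<in>S. w (u + m) * z (v + m) / ?F m)" for u v
  define Y where "Y = {(a, b, c, d). a \<in> A \<and> b \<in> B \<and> c \<in> A \<and> d \<in> B \<and> a + b = c + d}"
  define T where "T = {(u, v, m, m'). u + m \<in> A \<and> v + m' \<in> B \<and> u + m' \<in> A \<and> v + m \<in> B}"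
  define k where "k = (\<lambda>(a, b, c, d). p a * q b * (p c * q d))"
  define h where "h = (\<lambda>(u, v, m, m').
    w (u + m) * z (v + m') * w (u + m') * z (v + m) / (?F u * ?F v * ?F m * ?F m'))"
  \<comment> \<open>\<open>pair\<close> sends a table to its row sums followed by its column
    sums.\<close>
  define pair where "pair = (\<lambda>(u, v, m, m'). (u + m, v + m', u + m', v + m :: 'v multiset))"
  have finS: "finite S"
    using fin by (auto simp: S_def finite_subsets_mset)
  have finY: "finite Y"
    by (rule finite_subset[of _ "A \<times> B \<times> A \<times> B"]) (use fin in \<open>auto simp: Y_def\<close>)
  have TS: "T \<subseteq> S \<times> S \<times> S \<times> S"
    unfolding T_def S_def by (auto intro: mset_subset_eq_add_left mset_subset_eq_add_right)
  then have finT: "finite T"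
    using finS by (meson finite_SigmaI finite_subset)
  have pos: "?F a > 0" for a :: "'v multiset"
    using mset_fact_pos[of a] by simp

  \<comment> \<open>Squaring pairs two splittings \<open>a + b = c + d = s\<close>; \<open>Y\<close>
    collects these quadruples for all \<open>s\<close>.\<close>
  have expand: "(\<Sum>(a, b)\<in>{(a, b). a \<in> A \<and> b \<in> B \<and> a + b = s}. p a * q b)\<^sup>2 =
      (\<Sum>y\<in>{y \<in> Y. (\<lambda>(a, b, c, d). a + b) y = s}. k y)" for s
  proof -
    let ?X = "{(a, b). a \<in> A \<and> b \<in> B \<and> a + b = s}"
    have "(\<Sum>(a, b)\<in>?X. p a * q b)\<^sup>2 =
        (\<Sum>((a, b), (c, d))\<in>?X \<times> ?X. p a * q b * (p c * q d))"
      by (simp add: power2_eq_square sum_product sum.cartesian_product case_prod_unfold)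
    also have "\<dots> = (\<Sum>y\<in>{y \<in> Y. (\<lambda>(a, b, c, d). a + b) y = s}. k y)"
      by (rule sum.reindex_bij_witness[of _ "\<lambda>(a, b, c, d). ((a, b), (c, d))"
            "\<lambda>((a, b), (c, d)). (a, b, c, d)"]) (auto simp: Y_def k_def)
    finally show ?thesis .
  qed
  \<comment> \<open>The weight of \<open>a + b\<close> is spread over the tables with these margins;
    the four weights in the numerator are absorbed into \<open>w\<close> and
    \<open>z\<close>.\<close>
  have contingency: "?F (a + b) * k (a, b, c, d) = (\<Sum>x\<in>{x \<in> T. pair x = (a, b, c, d)}. h x)"
    if "(a, b, c, d) \<in> Y" for a b c d
  proof -
    have abcd: "a \<in> A" "b \<in> B" "c \<in> A" "d \<in> B" "a + b = c + d"
      using that by (auto simp: Y_def)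
    have "?F (a + b) * k (a, b, c, d) =
      (\<Sum>x | (\<lambda>(u, v, m, m'). u + m = a \<and> v + m' = b \<and> u + m' = c \<and> v + m = d) x.
        (\<lambda>(u, v, m, m'). ?F a * ?F b * ?F c * ?F d / (?F u * ?F v * ?F m * ?F m')) x * k (a, b, c, d))"
      unfolding mset_fact_contingency[OF abcd(5)] sum_distrib_right
      by (rule sum.cong) auto
    also have "\<dots> = (\<Sum>x\<in>{x \<in> T. pair x = (a, b, c, d)}. h x)"
      by (rule sum.cong) (use abcd in \<open>auto simp: T_def pair_def h_def k_def w_def z_def\<close>)
    finally show ?thesis .
  qed

  have "(\<Sum>(u, v)\<in>A \<times> B. ?F u * ?F v * (p u * q v)\<^sup>2) =
      (\<Sum>(u, v)\<in>A \<times> B. (R u v)\<^sup>2 / (?F u * ?F v))"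
  proof (rule sum.cong[OF refl], clarify)
    fix u v assume uv: "u \<in> A" "v \<in> B"
    have "R u v = (\<Sum>m\<in>{{#}}. w (u + m) * z (v + m) / ?F m)"
      unfolding R_def
    proof (rule sum.mono_neutral_right[OF finS], goal_cases)
      case 1
      then show ?case using uv by (auto simp: S_def)
    next
      case 2
      have "u + m \<notin> A" if "m \<noteq> {#}" for m
        using hom[of u] hom[of "u + m"] uv that by auto
      then show ?case by (auto simp: w_def)
    qed
    then have "R u v = ?F u * ?F v * (p u * q v)"
      using uv by (simp add: w_def z_def mset_fact_def)
    then show "?F u * ?F v * (p u * q v)\<^sup>2 = (R u v)\<^sup>2 / (?F u * ?F v)"
      using pos[of u] pos[of v] by (simp add: power2_eq_square)
  qed
  \<comment> \<open>The only inequality of the chain: the added terms are squares divided by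
    positive weights.\<close>
  also have "\<dots> \<le> (\<Sum>(u, v)\<in>S \<times> S. (R u v)\<^sup>2 / (?F u * ?F v))"
    by (rule sum_mono2) (use finS in \<open>auto simp: S_def\<close>)
  also have "\<dots> = (\<Sum>(u, v)\<in>S \<times> S. \<Sum>(m, m')\<in>S \<times> S. h (u, v, m, m'))"
  proof (rule sum.cong[OF refl], clarify)
    fix u v
    have "(R u v)\<^sup>2 / (?F u * ?F v) = (\<Sum>m\<in>S. \<Sum>m'\<in>S.
        (w (u + m) * z (v + m) / ?F m) * (w (u + m') * z (v + m') / ?F m') / (?F u * ?F v))"
      unfolding R_def power2_eq_square sum_product sum_divide_distrib ..
    also have "\<dots> = (\<Sum>m\<in>S. \<Sum>m'\<in>S. h (u, v, m, m'))"
      unfolding h_def prod.case divide_inverse inverse_mult_distrib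
      by (intro sum.cong refl) algebra
    finally show "(R u v)\<^sup>2 / (?F u * ?F v) = (\<Sum>(m, m')\<in>S \<times> S. h (u, v, m, m'))"
      by (simp add: sum.cartesian_product)
  qed
  also have "\<dots> = (\<Sum>x\<in>S \<times> S \<times> S \<times> S. h x)"
    by (simp add: sum.cartesian_product' case_prod_unfold)
  also have "\<dots> = (\<Sum>x\<in>T. h x)"
  proof (rule sum.mono_neutral_right[OF _ TS])
    have "h x = 0" if "x \<notin> T" for x
      using that by (cases x) (auto simp: T_def h_def w_def z_def)
    then show "\<forall>x\<in>S \<times> S \<times> S \<times> S - T. h x = 0" by blast
  qed (use finS in simp)
  \<comment> \<open>The tables are regrouped by their margins, and the margins then by the common
    total \<open>s\<close>.\<close>
  also have "\<dots> = (\<Sum>y\<in>Y. \<Sum>x\<in>{x \<in> T. pair x = y}. h x)"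
    by (rule sum.group[symmetric, OF finT finY]) (auto simp: T_def Y_def pair_def)
  also have "\<dots> = (\<Sum>y\<in>Y. (\<lambda>(a, b, c, d). ?F (a + b) * k (a, b, c, d)) y)"
    by (rule sum.cong[OF refl], clarify) (simp only: contingency)
  also have "\<dots> = (\<Sum>s\<in>?N. \<Sum>y\<in>{y \<in> Y. (\<lambda>(a, b, c, d). a + b) y = s}.
      (\<lambda>(a, b, c, d). ?F (a + b) * k (a, b, c, d)) y)"
    by (rule sum.group[symmetric, OF finY]) (use fin in \<open>auto simp: Y_def\<close>)
  also have "\<dots> = (\<Sum>s\<in>?N. ?F s * (\<Sum>(a, b)\<in>{(a, b). a \<in> A \<and> b \<in> B \<and> a + b = s}. p a * q b)\<^sup>2)"
    unfolding expand sum_distrib_left by (intro sum.cong refl) auto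
  finally show ?thesis by simp
qed

section \<open>Homogenization of Dirichlet polynomials\<close>

text \<open>The multidegree \<open>E\<close> is itself encoded as an integer: the monomial of \<open>i dvd E\<close> in the
  homogenizing variables \<open>Inr r\<close> is given by the codivisor \<open>E div i\<close>.\<close>

definition homog_index :: "nat \<Rightarrow> nat \<Rightarrow> (nat + nat) multiset" where
  "homog_index E i =
     image_mset Inl (prime_factorization i) + image_mset Inr (prime_factorization (E div i))"

text \<open>Codivisors multiply along with divisors, and factorization turns products into sums;
  thus Dirichlet multiplication becomes multiplication of monomials.\<close>

lemma homog_index_mult:
  assumes "j dvd E" "l dvd E'" "E > 0" "E' > 0"
  shows "homog_index E j + homog_index E' l = homog_index (E * E') (j * l)"
proof -
  obtain x y where "E = j * x" "E' = l * y" using assms by (auto elim!: dvdE)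
  moreover have "j * x * (l * y) div (j * l) = x * y"
    using assms calculation by (simp add: mult.assoc mult.left_commute[of x])
  ultimately show ?thesis using assms
    by (simp add: homog_index_def prime_factorization_mult)
qed

text \<open>The two parts together factor \<open>i * (E div i) = E\<close>, so all monomials have
  the same total degree: this is the homogeneity that Bombieri's inequality asks for.\<close>

lemma size_homog_index:
  assumes "i dvd E" "E > 0"
  shows "size (homog_index E i) = size (prime_factorization E)"
proof -
  obtain x where "E = i * x" using assms by (auto elim!: dvdE)
  with assms show ?thesis
    by (simp add: homog_index_def prime_factorization_mult)
qed

lemma count_homog_index:
  "count (homog_index E i) (Inl r) = count (prime_factorization i) r"
  "count (homog_index E i) (Inr r) = count (prime_factorization (E div i)) r"
proof -
  have *: "count (image_mset Inl M) (Inl r) = count M r" "count (image_mset Inr M) (Inr r) = count M r"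
     "count (image_mset Inr M) (Inl r) = 0" "count (image_mset Inl M) (Inr r) = 0"
    for M and r :: nat
    by (induction M) (auto simp: count_eq_zero_iff)
  show "count (homog_index E i) (Inl r) = count (prime_factorization i) r"
    "count (homog_index E i) (Inr r) = count (prime_factorization (E div i)) r"
    by (simp_all add: homog_index_def *)
qed

lemma inj_on_homog_index: "inj_on (homog_index E) {0<..}"
proof
  fix i j assume ij: "i \<in> {0<..}" "j \<in> {0<..}" "homog_index E i = homog_index E j"
  then have "prime_factorization i = prime_factorization j"
    by (metis count_homog_index(1) multiset_eqI)
  then have "prod_mset (prime_factorization i) = prod_mset (prime_factorization j)"
    by simp
  with ij show "i = j"
    by (simp add: prod_mset_prime_factorization_nat)
qed

section \<open>Support, degree, height and relevant primes of Dirichlet products\<close>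

lemma dirichlet_poly_gt_0: "dirichlet_poly g \<Longrightarrow> g j \<noteq> 0 \<Longrightarrow> j > 0"
  unfolding dirichlet_poly_def by (metis gr0I)

text \<open>Supports contain only positive indices, so at \<open>i = 0\<close> the restricted sum is
  empty, in agreement with the conventional value 0 of the sum over an infinite set.\<close>

lemma dirichlet_mult_eq:
  assumes "dirichlet_poly g" "dirichlet_poly h"
  shows "dirichlet_mult g h i = (\<Sum>(j, l) | g j \<noteq> 0 \<and> h l \<noteq> 0 \<and> j * l = i. g j * h l)"
proof (cases "i = 0")
  case True
  have inf: "infinite {(j, l :: nat). j * l = 0}"
  proof
    assume "finite {(j, l :: nat). j * l = 0}"
    moreover have "range (\<lambda>l. (0 :: nat, l :: nat)) \<subseteq> {(j, l). j * l = 0}"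
      by auto
    ultimately have "finite (range (\<lambda>l. (0 :: nat, l :: nat)))"
      using finite_subset by blast
    then show False
      by (simp add: finite_image_iff inj_on_def)
  qed
  have emp: "{(j, l). g j \<noteq> 0 \<and> h l \<noteq> 0 \<and> j * l = 0} = {}"
    using assms by (auto dest: dirichlet_poly_gt_0)
  show ?thesis
    unfolding dirichlet_mult_def True sum.infinite[OF inf] emp by simp
next
  case False
  have "{(j, l). j * l = i} \<subseteq> {..i} \<times> {..i}"
    using False by (auto intro: dvd_imp_le)
  then have "finite {(j, l). j * l = i}"
    by (rule finite_subset) simp
  then show ?thesis
    unfolding dirichlet_mult_def
    by (intro sum.mono_neutral_right) auto
qed

lemma dirichlet_mult_commute: "dirichlet_mult g h = dirichlet_mult h g"
  unfolding dirichlet_mult_def fun_eq_iff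
  by (intro allI sum.reindex_bij_witness[of _ prod.swap prod.swap]) (auto simp: mult.commute)

text \<open>The no-cancellation principle: an extremal index of the product, reached by one pair of
  supporting indices only, keeps a nonzero coefficient.\<close>

lemma dirichlet_mult_unique:
  assumes gh: "dirichlet_poly g" "dirichlet_poly h" and "g j \<noteq> 0" "h l \<noteq> 0"
    and "\<And>j' l'. g j' \<noteq> 0 \<Longrightarrow> h l' \<noteq> 0 \<Longrightarrow> j' * l' = j * l \<Longrightarrow> j' = j \<and> l' = l"
  shows "dirichlet_mult g h (j * l) = g j * h l"
proof -
  have "{(j', l'). g j' \<noteq> 0 \<and> h l' \<noteq> 0 \<and> j' * l' = j * l} = {(j, l)}"
    using assms by auto
  then show ?thesis
    by (simp add: dirichlet_mult_eq[OF gh])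
qed

lemma dirichlet_mult_support:
  assumes "dirichlet_poly g" "dirichlet_poly h" "dirichlet_mult g h i \<noteq> 0"
  obtains j l where "g j \<noteq> 0" "h l \<noteq> 0" "i = j * l"
proof -
  have "{(j, l). g j \<noteq> 0 \<and> h l \<noteq> 0 \<and> j * l = i} \<noteq> {}"
  proof
    assume empty: "{(j, l). g j \<noteq> 0 \<and> h l \<noteq> 0 \<and> j * l = i} = {}"
    show False
      using assms(3) unfolding dirichlet_mult_eq[OF assms(1,2)] empty by simp
  qed
  then show ?thesis using that by auto
qed

lemma dp_degree_ge: "dirichlet_poly f \<Longrightarrow> f i \<noteq> 0 \<Longrightarrow> i \<le> dp_degree f"
  by (simp add: dp_degree_def dirichlet_poly_def)

lemma dp_degree_coeff:
  assumes "dirichlet_poly f" "f i \<noteq> 0"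
  shows "f (dp_degree f) \<noteq> 0"
proof -
  have "Max {i. f i \<noteq> 0} \<in> {i. f i \<noteq> 0}"
    using assms by (intro Max_in) (auto simp: dirichlet_poly_def)
  then show ?thesis by (simp add: dp_degree_def)
qed

lemma abs_le_dp_height: "dirichlet_poly f \<Longrightarrow> f i \<noteq> 0 \<Longrightarrow> \<bar>f i\<bar> \<le> dp_height f"
  by (auto simp: dp_height_def dirichlet_poly_def)

lemma dp_height_attained:
  assumes "dirichlet_poly f" "f i \<noteq> 0"
  obtains j where "f j \<noteq> 0" "dp_height f = \<bar>f j\<bar>"
proof -
  have "Max ((\<lambda>i. \<bar>f i\<bar>) ` {i. f i \<noteq> 0}) \<in> (\<lambda>i. \<bar>f i\<bar>) ` {i. f i \<noteq> 0}"
    using assms by (intro Max_in) (auto simp: dirichlet_poly_def)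
  then show ?thesis using that by (auto simp: dp_height_def)
qed

lemma mult_eq_imp_eq_of_le:
  fixes a b c d :: nat
  assumes "a * b = c * d" "a \<le> c" "b \<le> d" "a > 0" "b > 0"
  shows "a = c \<and> b = d"
proof -
  have "a * b < c * d" if "a < c"
    using mult_less_le_imp_less[OF that assms(3)] assms by simp
  moreover have "a * b < c * d" if "b < d"
    using mult_le_less_imp_less[OF assms(2) that] assms by simp
  ultimately show ?thesis
    using assms by linarith
qed

lemma dirichlet_mult_dp_degree:
  assumes gh: "dirichlet_poly g" "dirichlet_poly h" and nz: "g j \<noteq> 0" "h l \<noteq> 0"
  shows "dirichlet_mult g h (dp_degree g * dp_degree h) = g (dp_degree g) * h (dp_degree h)"
proof (rule dirichlet_mult_unique[OF gh])
  fix j' l' assume jl: "g j' \<noteq> 0" "h l' \<noteq> 0" "j' * l' = dp_degree g * dp_degree h"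
  show "j' = dp_degree g \<and> l' = dp_degree h"
    by (rule mult_eq_imp_eq_of_le[OF jl(3)])
      (simp_all add: dp_degree_ge dirichlet_poly_gt_0[OF gh(1)] dirichlet_poly_gt_0[OF gh(2)] gh jl)
qed (use dp_degree_coeff gh nz in blast)+

lemma dirichlet_mult_le_degree:
  assumes "dirichlet_poly g" "dirichlet_poly h" "dirichlet_mult g h i \<noteq> 0"
  shows "i \<le> dp_degree g * dp_degree h"
  using assms(3)
  by (rule dirichlet_mult_support[OF assms(1,2)]) (auto intro: mult_le_mono dp_degree_ge assms)

lemma dirichlet_poly_mult:
  assumes "dirichlet_poly g" "dirichlet_poly h"
  shows "dirichlet_poly (dirichlet_mult g h)"
proof -
  have "finite {i. dirichlet_mult g h i \<noteq> 0}"
    by (rule finite_subset[of _ "{..dp_degree g * dp_degree h}"])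
      (use dirichlet_mult_le_degree[OF assms] in auto)
  moreover have "dirichlet_mult g h 0 = 0"
  proof (rule ccontr)
    assume "dirichlet_mult g h 0 \<noteq> 0"
    then obtain j l where "g j \<noteq> 0" "h l \<noteq> 0" "0 = j * l"
      using dirichlet_mult_support[OF assms] by blast
    then show False
      using dirichlet_poly_gt_0[OF assms(1), of j] dirichlet_poly_gt_0[OF assms(2), of l] by simp
  qed
  ultimately show ?thesis
    by (simp add: dirichlet_poly_def)
qed

lemma dp_degree_mult:
  assumes gh: "dirichlet_poly g" "dirichlet_poly h" and nz: "g j \<noteq> 0" "h l \<noteq> 0"
  shows "dp_degree (dirichlet_mult g h) = dp_degree g * dp_degree h"
proof -
  have "dirichlet_mult g h (dp_degree g * dp_degree h) \<noteq> 0"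
    using dp_degree_coeff[OF gh(1) nz(1)] dp_degree_coeff[OF gh(2) nz(2)]
    by (simp add: dirichlet_mult_dp_degree[OF gh nz])
  moreover have "finite {i. dirichlet_mult g h i \<noteq> 0}"
    using dirichlet_poly_mult[OF gh] by (simp add: dirichlet_poly_def)
  ultimately show ?thesis
    unfolding dp_degree_def[of "dirichlet_mult g h"] using dirichlet_mult_le_degree[OF gh]
    by (intro Max_eqI) auto
qed

text \<open>Cancellation cannot remove \<open>r\<close>: in each factor take the indices of maximal
  multiplicity at \<open>r\<close>, and among them the largest. The product of the two chosen
  indices arises only once.\<close>

lemma relevant_primes_mult:
  assumes gh: "dirichlet_poly g" "dirichlet_poly h" and nz: "g j \<noteq> 0" "h l \<noteq> 0"
    and r: "prime r" "r dvd j"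
  shows "r \<in> relevant_primes (dirichlet_mult g h)"
proof -
  have extremal: "\<exists>j. f j \<noteq> 0 \<and> (\<forall>j'. f j' \<noteq> 0 \<longrightarrow> multiplicity r j' \<le> multiplicity r j \<and>
      (multiplicity r j' = multiplicity r j \<longrightarrow> j' \<le> j))"
    if f: "dirichlet_poly f" "f i \<noteq> 0" for f :: "nat \<Rightarrow> int" and i
  proof -
    have fin: "finite {i. f i \<noteq> 0}" using f by (simp add: dirichlet_poly_def)
    define e where "e = Max (multiplicity r ` {i. f i \<noteq> 0})"
    have e: "e \<in> multiplicity r ` {i. f i \<noteq> 0}"
      unfolding e_def using fin f by (intro Max_in) auto
    define j where "j = Max {i. f i \<noteq> 0 \<and> multiplicity r i = e}"
    have "j \<in> {i. f i \<noteq> 0 \<and> multiplicity r i = e}"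
      unfolding j_def by (intro Max_in) (use fin e in auto)
    moreover have "multiplicity r j' \<le> e" if "f j' \<noteq> 0" for j'
      unfolding e_def using fin that by (intro Max_ge) auto
    moreover have "j' \<le> j" if "f j' \<noteq> 0" "multiplicity r j' = e" for j'
      unfolding j_def using fin that by (intro Max_ge) auto
    ultimately show ?thesis by blast
  qed
  obtain a where a: "g a \<noteq> 0"
    "\<And>j'. g j' \<noteq> 0 \<Longrightarrow> multiplicity r j' \<le> multiplicity r a"
    "\<And>j'. g j' \<noteq> 0 \<Longrightarrow> multiplicity r j' = multiplicity r a \<Longrightarrow> j' \<le> a"
    using extremal[OF gh(1) nz(1)] by blast
  obtain b where b: "h b \<noteq> 0"
    "\<And>j'. h j' \<noteq> 0 \<Longrightarrow> multiplicity r j' \<le> multiplicity r b"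
    "\<And>j'. h j' \<noteq> 0 \<Longrightarrow> multiplicity r j' = multiplicity r b \<Longrightarrow> j' \<le> b"
    using extremal[OF gh(2) nz(2)] by blast
  note pos = dirichlet_poly_gt_0[OF gh(1)] dirichlet_poly_gt_0[OF gh(2)]
  have mult: "multiplicity r (x * y) = multiplicity r x + multiplicity r y"
    if "x > 0" "y > 0" for x y
    using that r by (simp add: prime_elem_multiplicity_mult_distrib)
  have "dirichlet_mult g h (a * b) = g a * h b"
  proof (rule dirichlet_mult_unique[OF gh a(1) b(1)])
    fix j' l' assume jl: "g j' \<noteq> 0" "h l' \<noteq> 0" "j' * l' = a * b"
    have "multiplicity r j' + multiplicity r l' = multiplicity r a + multiplicity r b"
      using mult[of j' l'] mult[of a b] jl pos a(1) b(1) by simp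
    moreover have "multiplicity r j' \<le> multiplicity r a" "multiplicity r l' \<le> multiplicity r b"
      using jl a(2) b(2) by auto
    \<comment> \<open>The multiplicities have equal sums and are bounded termwise, so both are
      maximal and the tie-break by size applies.\<close>
    ultimately have "j' \<le> a" "l' \<le> b"
      using jl by (auto intro!: a(3) b(3))
    then show "j' = a \<and> l' = b"
      by (rule mult_eq_imp_eq_of_le[OF jl(3)]) (simp_all add: pos jl)
  qed
  moreover have "r dvd a"
  proof -
    have "multiplicity r j > 0"
      using r pos nz by (simp add: prime_multiplicity_gt_zero_iff)
    then have "multiplicity r a > 0" using a(2)[OF nz(1)] by simp
    then show ?thesis
      using not_dvd_imp_multiplicity_0 by fastforce
  qed
  ultimately show ?thesis
    using r a b by (auto simp: relevant_primes_def intro!: exI[of _ "a * b"])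
qed

text \<open>Bombieri's inequality transported along \<open>homog_index\<close>, with
  \<open>E\<close> and \<open>E'\<close> as multidegrees of the two factors.\<close>

lemma dirichlet_bombieri:
  assumes gh: "dirichlet_poly g" "dirichlet_poly h" and E: "E > 0" "E' > 0"
    and gE: "\<And>j. g j \<noteq> 0 \<Longrightarrow> j dvd E" and hE: "\<And>l. h l \<noteq> 0 \<Longrightarrow> l dvd E'"
  shows "(\<Sum>(j, l)\<in>{j. g j \<noteq> 0} \<times> {l. h l \<noteq> 0}.
      real (mset_fact (homog_index E j) * mset_fact (homog_index E' l)) * (real_of_int (g j * h l))\<^sup>2) \<le>
    (\<Sum>i | dirichlet_mult g h i \<noteq> 0.
      real (mset_fact (homog_index (E * E') i)) * (real_of_int (dirichlet_mult g h i))\<^sup>2)"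
proof -
  let ?G = "{j. g j \<noteq> 0}" and ?H = "{l. h l \<noteq> 0}"
  let ?I = "(\<lambda>(j, l). j * l) ` (?G \<times> ?H)"
  have fin: "finite ?G" "finite ?H"
    using gh by (auto simp: dirichlet_poly_def)
  have pos: "?G \<subseteq> {0<..}" "?H \<subseteq> {0<..}" "?I \<subseteq> {0<..}"
    using dirichlet_poly_gt_0 gh by auto
  note inj = inj_on_homog_index[THEN inj_on_subset]
  \<comment> \<open>Coefficients are carried over to monomials through the inverse of the injective
    encoding.\<close>
  define p where "p a = real_of_int (g (the_inv_into ?G (homog_index E) a))" for a
  define q where "q b = real_of_int (h (the_inv_into ?H (homog_index E') b))" for b
  have p: "p (homog_index E j) = g j" if "g j \<noteq> 0" for j
    using inj[OF pos(1)] that by (simp add: p_def the_inv_into_f_f)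
  have q: "q (homog_index E' l) = h l" if "h l \<noteq> 0" for l
    using inj[OF pos(2)] that by (simp add: q_def the_inv_into_f_f)
  have add: "homog_index E j + homog_index E' l = homog_index (E * E') (j * l)"
    if "g j \<noteq> 0" "h l \<noteq> 0" for j l
    using that gE hE E by (intro homog_index_mult) auto
  let ?A = "homog_index E ` ?G" and ?B = "homog_index E' ` ?H"
  have AB: "?A \<times> ?B = (\<lambda>(j, l). (homog_index E j, homog_index E' l)) ` (?G \<times> ?H)"
    by auto
  have injAB: "inj_on (\<lambda>(j, l). (homog_index E j, homog_index E' l)) (?G \<times> ?H)"
    using inj[OF pos(1), of E] inj[OF pos(2), of E'] by (auto simp: inj_on_def)
  have N: "(\<lambda>(a, b). a + b) ` (?A \<times> ?B) = homog_index (E * E') ` ?I"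
    unfolding AB image_image by (rule image_cong[OF refl]) (auto simp: add)
  have coeff: "(\<Sum>(a, b)\<in>{(a, b). a \<in> ?A \<and> b \<in> ?B \<and> a + b = homog_index (E * E') i}. p a * q b) =
      dirichlet_mult g h i" if "i \<in> ?I" for i
  proof -
    have iff: "j * l = i \<longleftrightarrow> homog_index (E * E') (j * l) = homog_index (E * E') i"
      if "g j \<noteq> 0" "h l \<noteq> 0" for j l
      using inj[OF pos(3), of "E * E'"] that \<open>i \<in> ?I\<close> by (auto simp: inj_on_def)
    have "{(a, b). a \<in> ?A \<and> b \<in> ?B \<and> a + b = homog_index (E * E') i} =
        (\<lambda>(j, l). (homog_index E j, homog_index E' l)) ` {(j, l). g j \<noteq> 0 \<and> h l \<noteq> 0 \<and> j * l = i}"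
      by (auto simp: add iff)
    moreover have "inj_on (\<lambda>(j, l). (homog_index E j, homog_index E' l))
        {(j, l). g j \<noteq> 0 \<and> h l \<noteq> 0 \<and> j * l = i}"
      by (rule inj_on_subset[OF injAB]) auto
    ultimately have "(\<Sum>(a, b)\<in>{(a, b). a \<in> ?A \<and> b \<in> ?B \<and> a + b = homog_index (E * E') i}. p a * q b) =
      (\<Sum>(j, l)\<in>{(j, l). g j \<noteq> 0 \<and> h l \<noteq> 0 \<and> j * l = i}. real_of_int (g j * h l))"
      by (auto simp: sum.reindex p q intro!: sum.cong)
    then show ?thesis
      by (simp add: dirichlet_mult_eq[OF gh] case_prod_unfold)
  qed
  have "(\<Sum>(j, l)\<in>?G \<times> ?H.
      real (mset_fact (homog_index E j) * mset_fact (homog_index E' l)) * (real_of_int (g j * h l))\<^sup>2) =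
    (\<Sum>(a, b)\<in>?A \<times> ?B. real (mset_fact a * mset_fact b) * (p a * q b)\<^sup>2)"
    unfolding AB sum.reindex[OF injAB] by (rule sum.cong) (auto simp: p q)
  also have "\<dots> \<le> (\<Sum>s\<in>(\<lambda>(a, b). a + b) ` (?A \<times> ?B). real (mset_fact s) *
       (\<Sum>(a, b)\<in>{(a, b). a \<in> ?A \<and> b \<in> ?B \<and> a + b = s}. p a * q b)\<^sup>2)"
    by (rule bombieri_inequality) (use fin gE E in \<open>auto simp: size_homog_index\<close>)
  also have "\<dots> = (\<Sum>i\<in>?I. real (mset_fact (homog_index (E * E') i)) * (real_of_int (dirichlet_mult g h i))\<^sup>2)"
    unfolding N sum.reindex[OF inj[OF pos(3)]] by (rule sum.cong[OF refl]) (simp only: coeff o_apply)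
  \<comment> \<open>Products of supporting indices may cancel; those indices contribute 0.\<close>
  also have "\<dots> = (\<Sum>i | dirichlet_mult g h i \<noteq> 0.
      real (mset_fact (homog_index (E * E') i)) * (real_of_int (dirichlet_mult g h i))\<^sup>2)"
  proof (rule sum.mono_neutral_right)
    show "{i. dirichlet_mult g h i \<noteq> 0} \<subseteq> ?I"
    proof
      fix i assume "i \<in> {i. dirichlet_mult g h i \<noteq> 0}"
      then obtain j l where "g j \<noteq> 0" "h l \<noteq> 0" "i = j * l"
        using dirichlet_mult_support[OF gh] by blast
      then show "i \<in> ?I"
        by (intro image_eqI[of _ _ "(j, l)"]) auto
    qed
  qed (use fin in auto)
  finally show ?thesis .
qed

section \<open>Coefficients of a factor\<close>

lemma mset_fact_homog_index:
  assumes "i dvd D" "D > 0"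
  shows "mset_fact (homog_index D i) =
    (\<Prod>r\<in>prime_factors D. fact (multiplicity r i) * fact (multiplicity r (D div i)))"
proof -
  let ?V = "prime_factors D"
  have "set_mset (homog_index D i) \<subseteq> ?V <+> ?V"
  proof -
    have "D div i dvd D" using assms by auto
    then have "prime_factors i \<subseteq> ?V" "prime_factors (D div i) \<subseteq> ?V"
      using assms by (intro dvd_prime_factors; simp)+
    then show ?thesis by (auto simp: homog_index_def)
  qed
  then have "mset_fact (homog_index D i) = (\<Prod>x\<in>?V <+> ?V. fact (count (homog_index D i) x))"
    by (intro mset_fact_superset) auto
  also have "\<dots> = (\<Prod>r\<in>?V. fact (multiplicity r i)) * (\<Prod>r\<in>?V. fact (multiplicity r (D div i)))"
    by (subst prod.Plus) (auto intro!: arg_cong2[of _ _ _ _ "(*)"] prod.cong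
        simp: count_homog_index count_prime_factorization_prime in_prime_factors_imp_prime)
  finally show ?thesis by (simp add: prod.distrib)
qed

text \<open>The multiplicity of a binary lcm is the maximum of the two, so a finite lcm attains its
  multiplicity at some member.\<close>

lemma multiplicity_Lcm_attained:
  fixes A :: "nat set"
  assumes "finite A" "A \<noteq> {}" "0 \<notin> A" "prime r"
  shows "\<exists>a\<in>A. multiplicity r (Lcm A) = multiplicity r a"
  using assms
proof (induction A rule: finite_ne_induct)
  case (insert x A)
  then have "x \<noteq> 0" "Lcm A \<noteq> 0" by (auto simp: Lcm_0_iff)
  then have "multiplicity r (Lcm (insert x A)) = max (multiplicity r x) (multiplicity r (Lcm A))"
    using insert.prems by (simp add: multiplicity_lcm)
  with insert show ?case by (auto simp: max_def)
qed auto

text \<open>By unique factorization a divisor is determined by its exponent vector on the primes of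
  \<open>D\<close>.\<close>

lemma card_divisors_le:
  fixes D :: nat
  assumes "D > 0"
  shows "card {i. i dvd D} \<le> (\<Prod>r\<in>prime_factors D. multiplicity r D + 1)"
proof -
  let ?V = "prime_factors D"
  let ?f = "\<lambda>i. restrict (\<lambda>r. multiplicity r i) ?V"
  have "inj_on ?f {i. i dvd D}"
  proof (rule inj_onI)
    fix i j assume ij: "i \<in> {i. i dvd D}" "j \<in> {i. i dvd D}" "?f i = ?f j"
    have "multiplicity r i = multiplicity r j" if "prime r" for r
    proof (cases "r \<in> ?V")
      case True
      then show ?thesis using fun_cong[OF ij(3), of r] by simp
    next
      case False
      then have "\<not> r dvd D" using that assms by (auto simp: prime_factors_dvd)
      then have "\<not> r dvd i" "\<not> r dvd j" using ij by (auto dest: dvd_trans)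
      then show ?thesis by (simp add: not_dvd_imp_multiplicity_0)
    qed
    moreover have "i > 0" "j > 0" using ij assms by (auto intro: Nat.gr0I)
    ultimately show "i = j" using multiplicity_eq_nat by blast
  qed
  moreover have "?f ` {i. i dvd D} \<subseteq> (\<Pi>\<^sub>E r\<in>?V. {..multiplicity r D})"
    using assms by (auto intro!: dvd_imp_multiplicity_le)
  moreover have "finite (\<Pi>\<^sub>E r\<in>?V. {..multiplicity r D})"
    by (intro finite_PiE) auto
  ultimately have "card {i. i dvd D} \<le> card (\<Pi>\<^sub>E r\<in>?V. {..multiplicity r D})"
    by (rule card_inj_on_le)
  then show ?thesis by (simp add: card_PiE)
qed

text \<open>The factor \<open>8\<close> gained over the trivial bound \<open>4 ^ d\<close> for a multinomial coefficient with
  four parts is needed for small \<open>d\<close>.\<close>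

lemma fact_le_four_parts:
  assumes "d \<ge> 2" "a + a' + b + b' = d"
  shows "8 * fact d \<le> (4 ^ d * (fact a * fact a' * fact b * fact b') :: nat)"
  using assms
proof (induction d arbitrary: a a' b b' rule: dec_induct)
  case base
  \<comment> \<open>For \<open>d = 2\<close> the constants on both sides equal 16, so it is enough
    that the factorials are at least 1.\<close>
  have "1 * 1 * 1 * 1 \<le> (fact a * fact a' * fact b * fact b' :: nat)"
    by (intro mult_le_mono fact_ge_1)
  then show ?case by (simp add: fact_2)
next
  case (step d)
  let ?P = "\<lambda>a a' b b'. fact a * fact a' * fact b * fact b' :: nat"
  \<comment> \<open>The induction hypothesis with one part lowered by 1, multiplied by that part.
    The four resulting bounds add up to the factor \<open>Suc d\<close> on the left and the extra
    factor 4 on the right.\<close>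
  have part: "Suc y * (8 * fact d) \<le> 4 ^ d * w"
    if "8 * fact d \<le> 4 ^ d * z" "w = Suc y * z" for y z w :: nat
    using mult_le_mono2[OF that(1), of "Suc y"] unfolding that(2) mult.left_commute[of "4 ^ d"] .
  have "a * (8 * fact d) \<le> 4 ^ d * ?P a a' b b'"
  proof (cases a)
    case (Suc y)
    have "8 * fact d \<le> 4 ^ d * ?P y a' b b'"
      by (rule step.IH) (use Suc step.prems in simp)
    then show ?thesis
      unfolding Suc by (rule part) (simp only: fact_Suc of_nat_id mult_ac)
  qed simp
  moreover have "a' * (8 * fact d) \<le> 4 ^ d * ?P a a' b b'"
  proof (cases a')
    case (Suc y)
    have "8 * fact d \<le> 4 ^ d * ?P a y b b'"
      by (rule step.IH) (use Suc step.prems in simp)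
    then show ?thesis
      unfolding Suc by (rule part) (simp only: fact_Suc of_nat_id mult_ac)
  qed simp
  moreover have "b * (8 * fact d) \<le> 4 ^ d * ?P a a' b b'"
  proof (cases b)
    case (Suc y)
    have "8 * fact d \<le> 4 ^ d * ?P a a' y b'"
      by (rule step.IH) (use Suc step.prems in simp)
    then show ?thesis
      unfolding Suc by (rule part) (simp only: fact_Suc of_nat_id mult_ac)
  qed simp
  moreover have "b' * (8 * fact d) \<le> 4 ^ d * ?P a a' b b'"
  proof (cases b')
    case (Suc y)
    have "8 * fact d \<le> 4 ^ d * ?P a a' b y"
      by (rule step.IH) (use Suc step.prems in simp)
    then show ?thesis
      unfolding Suc by (rule part) (simp only: fact_Suc of_nat_id mult_ac)
  qed simp
  moreover have "8 * fact (Suc d) = (a + a' + b + b') * (8 * fact d)"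
    using step by simp
  ultimately show ?case
    by (simp only: distrib_right power_Suc)
qed

text \<open>The contribution of one prime, used with \<open>N = n / 2\<close>: \<open>d + 1\<close>
  counts exponents and the factorials are weights. The cube arises from
  \<open>2 ^ d * 4 ^ d = (2 ^ d) ^ 3 \<le> 8 * N ^ 3\<close>, whose 8 is cancelled by
  \<open>fact_le_four_parts\<close>; for \<open>d \<le> 1\<close> already
  \<open>2 \<le> N ^ 3\<close>.\<close>

lemma local_factor_bound:
  fixes N :: real
  assumes "N \<ge> 2" "2 ^ d \<le> 2 * N" "a + a' + b + b' = d"
  shows "real (d + 1) * fact d \<le> N ^ 3 * (fact a * fact a' * fact b * fact b')"
proof (cases "d \<ge> 2")
  case True
  let ?P = "fact a * fact a' * fact b * fact b' :: nat"
  have "real (8 * fact d) \<le> real (4 ^ d * ?P)"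
    using fact_le_four_parts[OF True assms(3)] by (rule of_nat_mono)
  then have "8 * (real (d + 1) * fact d) \<le> real (d + 1) * (4 ^ d * real ?P)"
    by (simp add: mult.left_commute mult_left_mono del: of_nat_add of_nat_Suc)
  also have "\<dots> \<le> 2 ^ d * (4 ^ d * real ?P)"
  proof (rule mult_right_mono)
    have "d + 1 \<le> 2 ^ d" using less_exp[of d] by linarith
    then show "real (d + 1) \<le> 2 ^ d" using of_nat_mono[of "d + 1" "2 ^ d", where 'a = real] by simp
  qed simp
  also have "\<dots> = (2 ^ d) ^ 3 * real ?P"
    using power_mult_distrib[of "2 :: real" 2 d] by (simp add: power3_eq_cube)
  also have "\<dots> \<le> (2 * N) ^ 3 * real ?P"
    using assms by (intro mult_right_mono power_mono) auto
  also have "\<dots> = 8 * (N ^ 3 * real ?P)"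
    by (simp add: power_mult_distrib)
  finally show ?thesis by simp
next
  case False
  then have "d = 0 \<or> d = 1" by auto
  then have "real (d + 1) * fact d \<le> 2" by auto
  also have "2 \<le> (2 :: real) ^ 3 * (1 * 1 * 1 * 1)" by simp
  also have "\<dots> \<le> N ^ 3 * (fact a * fact a' * fact b * fact b')"
    using assms by (intro mult_mono power_mono fact_ge_1) auto
  finally show ?thesis .
qed

text \<open>Compare a single term on the left of the Bombieri inequality with the whole right-hand side;
  the resulting quotient of weights factors over the primes.\<close>

lemma factor_coeff_bound:
  assumes gh: "dirichlet_poly g" "dirichlet_poly h" and nz: "g j \<noteq> 0" "h l \<noteq> 0"
    and n: "dp_degree (dirichlet_mult g h) = n" "n \<ge> 4"
    and k: "card (relevant_primes (dirichlet_mult g h)) = k"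
  shows "(real_of_int (g j))\<^sup>2 \<le>
    (real_of_int (dp_height (dirichlet_mult g h)))\<^sup>2 * (real n / 2) ^ (3 * k)"
proof -
  define f where "f = dirichlet_mult g h"
  \<comment> \<open>The least common multiples keep the multidegrees tight: each multiplicity in
    \<open>E\<close> or \<open>E'\<close> is attained by a supporting index.\<close>
  define E where "E = Lcm {j. g j \<noteq> 0}"
  define E' where "E' = Lcm {l. h l \<noteq> 0}"
  define D where "D = E * E'"
  let ?H = "real_of_int (dp_height f)" and ?N = "real n / 2"
  let ?F = "\<lambda>a. real (mset_fact a)"
  let ?V = "prime_factors D"
  have fin: "finite {j. g j \<noteq> 0}" "finite {l. h l \<noteq> 0}" and gh0: "g 0 = 0" "h 0 = 0"
    using gh by (auto simp: dirichlet_poly_def)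
  then have E: "E > 0" "E' > 0"
    by (auto simp: E_def E'_def Lcm_0_iff intro!: Nat.gr0I)
  then have D: "D > 0" by (simp add: D_def)
  have gE: "j dvd E" if "g j \<noteq> 0" for j using that by (simp add: E_def)
  have hE: "l dvd E'" if "h l \<noteq> 0" for l using that by (simp add: E'_def)
  have fD: "i dvd D" if "f i \<noteq> 0" for i
    using that unfolding f_def D_def
    by (elim dirichlet_mult_support[OF gh]) (auto intro: mult_dvd_mono gE hE)
  have f: "dirichlet_poly f"
    unfolding f_def by (rule dirichlet_poly_mult[OF gh])
  have Lcm_g: "\<exists>i. g i \<noteq> 0 \<and> multiplicity r E = multiplicity r i" if "prime r" for r
    using multiplicity_Lcm_attained[of "{j. g j \<noteq> 0}" r] fin(1) nz(1) gh0 that unfolding E_def by auto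
  have Lcm_h: "\<exists>i. h i \<noteq> 0 \<and> multiplicity r E' = multiplicity r i" if "prime r" for r
    using multiplicity_Lcm_attained[of "{l. h l \<noteq> 0}" r] fin(2) nz(2) gh0 that unfolding E'_def by auto
  have V: "?V \<subseteq> relevant_primes f"
  proof
    fix r assume "r \<in> ?V"
    then have r: "prime r" "r dvd E \<or> r dvd E'"
      using D by (auto simp: D_def prime_factors_dvd prime_dvd_mult_iff)
    from r(2) show "r \<in> relevant_primes f"
    proof
      assume "r dvd E"
      then have "multiplicity r E > 0" using r E by (simp add: prime_multiplicity_gt_zero_iff)
      then obtain i where "g i \<noteq> 0" "multiplicity r i > 0"
        using Lcm_g[OF r(1)] by auto
      moreover from this have "r dvd i" using not_dvd_imp_multiplicity_0 by fastforce
      ultimately show ?thesis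
        unfolding f_def by (intro relevant_primes_mult[OF gh _ nz(2) r(1)])
    next
      assume "r dvd E'"
      then have "multiplicity r E' > 0" using r E by (simp add: prime_multiplicity_gt_zero_iff)
      then obtain i where "h i \<noteq> 0" "multiplicity r i > 0"
        using Lcm_h[OF r(1)] by auto
      moreover from this have "r dvd i" using not_dvd_imp_multiplicity_0 by fastforce
      ultimately show ?thesis
        unfolding f_def dirichlet_mult_commute[of g]
        by (intro relevant_primes_mult[OF gh(2,1) _ nz(1) r(1)])
    qed
  qed
  have "finite (relevant_primes f)"
  proof (rule finite_subset)
    show "relevant_primes f \<subseteq> ?V"
      using fD D by (auto simp: relevant_primes_def prime_factors_dvd intro: dvd_trans)
  qed simp
  then have cardV: "card ?V \<le> k"
    using card_mono[OF _ V] k by (simp add: f_def)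
  \<comment> \<open>The multiplicity in \<open>D\<close> splits over indices \<open>i\<close> of
    \<open>g\<close> and \<open>i'\<close> of \<open>h\<close> attaining it, and
    \<open>i * i'\<close> is at most the product of the degrees, which is \<open>n\<close>.\<close>
  have pow_le: "2 ^ multiplicity r D \<le> n" if r: "r \<in> ?V" for r
  proof -
    have "prime r" using r by auto
    have aux: "2 ^ multiplicity r i \<le> i" if "i > 0" for i
    proof -
      have "2 ^ multiplicity r i \<le> r ^ multiplicity r i"
        using prime_ge_2_nat[OF \<open>prime r\<close>] by (rule power_mono) simp
      also have "\<dots> \<le> i" using that by (intro dvd_imp_le multiplicity_dvd)
      finally show ?thesis .
    qed
    obtain i where i: "g i \<noteq> 0" "multiplicity r E = multiplicity r i"
      using Lcm_g[OF \<open>prime r\<close>] by auto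
    obtain i' where i': "h i' \<noteq> 0" "multiplicity r E' = multiplicity r i'"
      using Lcm_h[OF \<open>prime r\<close>] by auto
    have "(2 :: nat) ^ multiplicity r D = 2 ^ multiplicity r i * 2 ^ multiplicity r i'"
      using E \<open>prime r\<close> i i' unfolding D_def
      by (simp add: prime_elem_multiplicity_mult_distrib power_add)
    also have "\<dots> \<le> i * i'"
      using aux i i' gh dirichlet_poly_gt_0 by (intro mult_le_mono) auto
    also have "\<dots> \<le> dp_degree g * dp_degree h"
      using i i' gh by (intro mult_le_mono dp_degree_ge)
    finally show ?thesis using dp_degree_mult[OF gh nz] n by simp
  qed

  have weight_le: "?F (homog_index D i) \<le> (\<Prod>r\<in>?V. fact (multiplicity r D))" if "f i \<noteq> 0" for i
  proof -
    have "fact (multiplicity r i) * fact (multiplicity r (D div i)) \<le> (fact (multiplicity r D) :: nat)"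
      if "r \<in> ?V" for r
    proof -
      obtain x where x: "D = i * x" using fD \<open>f i \<noteq> 0\<close> by blast
      then have "multiplicity r D = multiplicity r i + multiplicity r (D div i)"
        using D in_prime_factors_imp_prime[OF that] by (simp add: prime_elem_multiplicity_mult_distrib)
      then show ?thesis
        using dvd_imp_le[OF fact_fact_dvd_fact[of "multiplicity r i" "multiplicity r (D div i)"]] by simp
    qed
    then have "mset_fact (homog_index D i) \<le> (\<Prod>r\<in>?V. fact (multiplicity r D))"
      unfolding mset_fact_homog_index[OF fD[OF that] D] by (intro prod_mono) auto
    from of_nat_mono[OF this, where 'a = real] show ?thesis by simp
  qed
  \<comment> \<open>The integer \<open>h l\<close> is nonzero, so its square is at least 1 and may
    be dropped from the product of coefficients.\<close>
  have "?F (homog_index E j) * ?F (homog_index E' l) * (real_of_int (g j))\<^sup>2 * 1 \<le>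
      ?F (homog_index E j) * ?F (homog_index E' l) * (real_of_int (g j))\<^sup>2 * (real_of_int (h l))\<^sup>2"
  proof (rule mult_left_mono)
    have "1 \<le> \<bar>h l\<bar>" using nz by simp
    then have "1 \<le> (h l)\<^sup>2" using one_le_power[of "\<bar>h l\<bar>" 2] by simp
    then have "real_of_int 1 \<le> real_of_int ((h l)\<^sup>2)" by (simp only: of_int_le_iff)
    then show "1 \<le> (real_of_int (h l))\<^sup>2" by simp
  qed simp
  also have "\<dots> = (\<Sum>(j, l)\<in>{(j, l)}. ?F (homog_index E j) * ?F (homog_index E' l) * (real_of_int (g j * h l))\<^sup>2)"
    by (simp add: power_mult_distrib)
  also have "\<dots> \<le> (\<Sum>(j, l)\<in>{j. g j \<noteq> 0} \<times> {l. h l \<noteq> 0}.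
      ?F (homog_index E j) * ?F (homog_index E' l) * (real_of_int (g j * h l))\<^sup>2)"
    by (rule sum_mono2) (use fin nz in auto)
  also have "\<dots> \<le> (\<Sum>i | f i \<noteq> 0. ?F (homog_index D i) * (real_of_int (f i))\<^sup>2)"
    using dirichlet_bombieri[OF gh E gE hE] by (simp add: f_def D_def)
  also have "\<dots> \<le> (\<Sum>i | f i \<noteq> 0. (\<Prod>r\<in>?V. fact (multiplicity r D)) * ?H\<^sup>2)"
  proof (rule sum_mono)
    fix i assume i: "i \<in> {i. f i \<noteq> 0}"
    then have "real_of_int \<bar>f i\<bar> \<le> ?H"
      using abs_le_dp_height[OF f] by (simp only: of_int_le_iff mem_Collect_eq)
    then have "(real_of_int (f i))\<^sup>2 \<le> ?H\<^sup>2"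
      using power_mono[of "\<bar>real_of_int (f i)\<bar>" ?H 2] by simp
    then show "?F (homog_index D i) * (real_of_int (f i))\<^sup>2 \<le> (\<Prod>r\<in>?V. fact (multiplicity r D)) * ?H\<^sup>2"
      using i weight_le by (intro mult_mono prod_nonneg) auto
  qed
  also have "\<dots> = real (card {i. f i \<noteq> 0}) * ((\<Prod>r\<in>?V. fact (multiplicity r D)) * ?H\<^sup>2)"
    by simp
  \<comment> \<open>The support of \<open>f\<close> consists of divisors of
    \<open>D\<close>.\<close>
  also have "\<dots> \<le> (\<Prod>r\<in>?V. real (multiplicity r D + 1)) * ((\<Prod>r\<in>?V. fact (multiplicity r D)) * ?H\<^sup>2)"
  proof (rule mult_right_mono)
    have "card {i. f i \<noteq> 0} \<le> card {i. i dvd D}"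
      using fD D by (intro card_mono) auto
    also note card_divisors_le[OF D]
    finally have "card {i. f i \<noteq> 0} \<le> (\<Prod>r\<in>?V. multiplicity r D + 1)" .
    from of_nat_mono[OF this, where 'a = real]
    show "real (card {i. f i \<noteq> 0}) \<le> (\<Prod>r\<in>?V. real (multiplicity r D + 1))"
      by simp
  qed (auto intro!: mult_nonneg_nonneg prod_nonneg)
  also have "\<dots> = (\<Prod>r\<in>?V. real (multiplicity r D + 1) * fact (multiplicity r D)) * ?H\<^sup>2"
    by (simp only: prod.distrib mult.assoc)
  also have "\<dots> \<le> (\<Prod>r\<in>?V. ?N ^ 3 * (fact (multiplicity r j) * fact (multiplicity r (E div j)) *
      fact (multiplicity r l) * fact (multiplicity r (E' div l)))) * ?H\<^sup>2"
  proof (intro mult_right_mono prod_mono conjI)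
    fix r assume r: "r \<in> ?V"
    obtain x y where xy: "E = j * x" "E' = l * y" using gE hE nz by blast
    have "2 ^ multiplicity r D \<le> 2 * ?N"
      using of_nat_mono[OF pow_le[OF r], where 'a = real] by simp
    moreover have "multiplicity r j + multiplicity r (E div j) + multiplicity r l + multiplicity r (E' div l) =
        multiplicity r D"
      using E xy in_prime_factors_imp_prime[OF r] unfolding D_def
      by (simp add: prime_elem_multiplicity_mult_distrib)
    ultimately show "real (multiplicity r D + 1) * fact (multiplicity r D) \<le>
      ?N ^ 3 * (fact (multiplicity r j) * fact (multiplicity r (E div j)) *
      fact (multiplicity r l) * fact (multiplicity r (E' div l)))"
      using n by (intro local_factor_bound) auto
  qed auto
  also have "\<dots> = (?N ^ 3) ^ card ?V * ?H\<^sup>2 * (?F (homog_index E j) * ?F (homog_index E' l))"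
  proof -
    \<comment> \<open>The product may run over all primes of \<open>D\<close>: one not dividing
      \<open>A\<close> contributes \<open>0! * 0! = 1\<close>.\<close>
    have "mset_fact (homog_index A i) = (\<Prod>r\<in>?V. fact (multiplicity r i) * fact (multiplicity r (A div i)))"
      if "i dvd A" "A dvd D" for A i
    proof -
      have "A > 0" using that D by (auto intro: Nat.gr0I)
      have "fact (multiplicity r i) * fact (multiplicity r (A div i)) = (1 :: nat)"
        if "r \<in> ?V - prime_factors A" for r
      proof -
        have "\<not> r dvd A" using that \<open>A > 0\<close> by (auto simp: prime_factors_dvd)
        moreover have "i dvd A" "A div i dvd A" using \<open>i dvd A\<close> by auto
        ultimately have "\<not> r dvd i" "\<not> r dvd A div i" using dvd_trans by blast+
        then show ?thesis by (simp add: not_dvd_imp_multiplicity_0)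
      qed
      moreover have "prime_factors A \<subseteq> ?V"
        using that D by (intro dvd_prime_factors) auto
      ultimately show ?thesis
        unfolding mset_fact_homog_index[OF that(1) \<open>A > 0\<close>] by (intro prod.mono_neutral_left) auto
    qed
    from this[of j E] this[of l E'] gE hE nz show ?thesis
      by (simp add: D_def prod.distrib power_mult)
  qed
  finally have le: "?F (homog_index E j) * ?F (homog_index E' l) * (real_of_int (g j))\<^sup>2 * 1 \<le>
      (?N ^ 3) ^ card ?V * ?H\<^sup>2 * (?F (homog_index E j) * ?F (homog_index E' l))" .
  have "?F (homog_index E j) * ?F (homog_index E' l) > 0"
    using mset_fact_pos[of "homog_index E j"] mset_fact_pos[of "homog_index E' l"] by simp
  moreover have "X \<le> C" if "W * X * 1 \<le> C * W" "W > 0" for W X C :: real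
    using that by (simp add: mult.commute[of C])
  ultimately have "(real_of_int (g j))\<^sup>2 \<le> (?N ^ 3) ^ card ?V * ?H\<^sup>2"
    using le by blast
  also have "\<dots> = ?N ^ (3 * card ?V) * ?H\<^sup>2"
    by (simp only: power_mult)
  also have "\<dots> \<le> ?N ^ (3 * k) * ?H\<^sup>2"
    using cardV n by (intro mult_right_mono power_increasing) auto
  finally show ?thesis unfolding f_def mult.commute[of "?N ^ (3 * k)"] .
qed

section \<open>Values of a factor\<close>

text \<open>The value at \<open>-T\<close> as an integer, so that divisibility by the prime
  \<open>P\<close> makes sense.\<close>

definition dp_value :: "(nat \<Rightarrow> int) \<Rightarrow> nat \<Rightarrow> int" where
  "dp_value f T = (\<Sum>i | f i \<noteq> 0. f i * int i ^ T)"

lemma dp_eval_eq_dp_value: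
  assumes "dirichlet_poly f"
  shows "dp_eval f (- real T) = real_of_int (dp_value f T)"
proof -
  have "real_of_int (f i) / real i powr (- real T) = real_of_int (f i * int i ^ T)" if "f i \<noteq> 0" for i
    using dirichlet_poly_gt_0[OF assms that] by (simp add: powr_minus powr_realpow divide_inverse)
  then show ?thesis
    by (simp add: dp_eval_def dp_value_def)
qed

lemma dp_value_mult:
  assumes gh: "dirichlet_poly g" "dirichlet_poly h"
  shows "dp_value (dirichlet_mult g h) T = dp_value g T * dp_value h T"
proof -
  let ?X = "{j. g j \<noteq> 0} \<times> {l. h l \<noteq> 0}"
  let ?I = "(\<lambda>(j, l). j * l) ` ?X"
  have fin: "finite ?X"
    using gh by (auto simp: dirichlet_poly_def)
  have "dp_value g T * dp_value h T = (\<Sum>(j, l)\<in>?X. g j * h l * int (j * l) ^ T)"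
    unfolding dp_value_def sum_product sum.cartesian_product
    by (rule sum.cong) (auto simp: power_mult_distrib)
  also have "\<dots> = (\<Sum>i\<in>?I. \<Sum>x | x \<in> ?X \<and> (\<lambda>(j, l). j * l) x = i.
      (\<lambda>(j, l). g j * h l * int (j * l) ^ T) x)"
    by (rule sum.group[symmetric]) (use fin in auto)
  also have "\<dots> = (\<Sum>i\<in>?I. dirichlet_mult g h i * int i ^ T)"
  proof (rule sum.cong[OF refl])
    fix i
    have "(\<Sum>x | x \<in> ?X \<and> (\<lambda>(j, l). j * l) x = i. (\<lambda>(j, l). g j * h l * int (j * l) ^ T) x) =
        (\<Sum>(j, l) | g j \<noteq> 0 \<and> h l \<noteq> 0 \<and> j * l = i. g j * h l * int i ^ T)"
      by (rule sum.cong) auto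
    then show "(\<Sum>x | x \<in> ?X \<and> (\<lambda>(j, l). j * l) x = i. (\<lambda>(j, l). g j * h l * int (j * l) ^ T) x) =
        dirichlet_mult g h i * int i ^ T"
      by (simp add: dirichlet_mult_eq[OF gh] sum_distrib_right case_prod_unfold)
  qed
  also have "\<dots> = dp_value (dirichlet_mult g h) T"
    unfolding dp_value_def
  proof (rule sum.mono_neutral_right)
    show "{i. dirichlet_mult g h i \<noteq> 0} \<subseteq> ?I"
    proof
      fix i assume "i \<in> {i. dirichlet_mult g h i \<noteq> 0}"
      then obtain j l where "g j \<noteq> 0" "h l \<noteq> 0" "i = j * l"
        using dirichlet_mult_support[OF gh] by blast
      then show "i \<in> ?I"
        by (intro image_eqI[of _ _ "(j, l)"]) auto
    qed
  qed (use fin in auto)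
  finally show ?thesis ..
qed

text \<open>The leading coefficient is a nonzero integer, hence at least 1 in absolute value. With
  the degree written \<open>Suc d\<close>, there are at most \<open>d\<close> other terms, each
  bounded by the height times \<open>d ^ T\<close>.\<close>

lemma dp_value_ge:
  assumes g: "dirichlet_poly g" "g j \<noteq> 0" and m: "dp_degree g = Suc d"
  shows "int (Suc d) ^ T - dp_height g * (int d * int d ^ T) \<le> \<bar>dp_value g T\<bar>"
proof -
  let ?S = "{i. g i \<noteq> 0} - {Suc d}"
  have gm: "g (Suc d) \<noteq> 0"
    using dp_degree_coeff[OF g] m by simp
  have H: "dp_height g \<ge> 0"
    using abs_le_dp_height[OF g] by linarith
  have S: "?S \<subseteq> {1..d}"
  proof
    fix i assume i: "i \<in> ?S"
    then have "i \<le> Suc d" using dp_degree_ge[OF g(1), of i] m by simp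
    with i dirichlet_poly_gt_0[OF g(1), of i] show "i \<in> {1..d}" by auto
  qed
  have "\<bar>\<Sum>i\<in>?S. g i * int i ^ T\<bar> \<le> (\<Sum>i\<in>?S. dp_height g * int d ^ T)"
  proof (rule order.trans[OF sum_abs], rule sum_mono)
    fix i assume i: "i \<in> ?S"
    then have "\<bar>g i\<bar> \<le> dp_height g" using abs_le_dp_height[OF g(1)] by simp
    moreover have "int i ^ T \<le> int d ^ T" using i S by (intro power_mono) auto
    ultimately show "\<bar>g i * int i ^ T\<bar> \<le> dp_height g * int d ^ T"
      unfolding abs_mult using H by (intro mult_mono) auto
  qed
  also have "\<dots> = int (card ?S) * (dp_height g * int d ^ T)"
    by simp
  also have "\<dots> \<le> int d * (dp_height g * int d ^ T)"
    using card_mono[OF _ S] H by (intro mult_right_mono) auto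
  finally have tail: "\<bar>\<Sum>i\<in>?S. g i * int i ^ T\<bar> \<le> dp_height g * (int d * int d ^ T)"
    by (simp only: mult.left_commute)
  have "1 * int (Suc d) ^ T \<le> \<bar>g (Suc d)\<bar> * int (Suc d) ^ T"
    using gm by (intro mult_right_mono) auto
  also have "\<dots> = \<bar>g (Suc d) * int (Suc d) ^ T\<bar>"
    by (simp add: abs_mult)
  finally have lead: "int (Suc d) ^ T \<le> \<bar>g (Suc d) * int (Suc d) ^ T\<bar>" by simp
  have "dp_value g T = g (Suc d) * int (Suc d) ^ T + (\<Sum>i\<in>?S. g i * int i ^ T)"
    unfolding dp_value_def using g gm by (intro sum.remove) (auto simp: dirichlet_poly_def)
  with tail lead show ?thesis by linarith
qed

text \<open>From \<open>ln y \<le> y - 1\<close> at \<open>y = d / (d + 1)\<close> follows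
  \<open>1 / (d + 1) \<le> ln ((d + 1) / d)\<close>; so \<open>T / M\<close> is at most the
  logarithm of the \<open>T\<close>-th power of the ratio.\<close>

lemma power_ratio_gt:
  fixes M c :: real
  assumes "d > 0" "real (Suc d) \<le> M" "c > 0" "M * ln c < real T"
  shows "c * real d ^ T < real (Suc d) ^ T"
proof -
  let ?x = "real (Suc d) / real d"
  have x: "?x > 0" using assms by simp
  have "ln (1 / ?x) \<le> 1 / ?x - 1"
    by (rule ln_le_minus_one) (use x in \<open>simp only: zero_less_divide_1_iff\<close>)
  then have ln_ge: "1 / real (Suc d) \<le> ln ?x"
    using assms by (simp add: ln_div field_simps)
  have "ln c < real T / M"
    using assms by (simp add: field_simps)
  also have "\<dots> \<le> real T * (1 / real (Suc d))"
    using assms by (simp add: frac_le)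
  also have "\<dots> \<le> real T * ln ?x"
    using ln_ge by (intro mult_left_mono) auto
  also have "\<dots> = ln (?x ^ T)"
    using x by (simp add: ln_realpow)
  finally have "c < ?x ^ T"
    using assms x by (subst (asm) ln_less_cancel_iff) auto
  then show ?thesis
    using assms by (simp add: power_divide field_simps)
qed

text \<open>Bounds the first factor only; commutativity gives the second. Positivity of
  \<open>t\<close> is included because the value is taken at \<open>nat t\<close>.\<close>

lemma factor_value_gt:
  fixes q p n k :: nat and t :: int
  assumes gh: "dirichlet_poly g" "dirichlet_poly h" and nc: "\<not> dp_constant g" "\<not> dp_constant h"
    and n: "dp_degree (dirichlet_mult g h) = n"
    and p: "p = Min (prime_factors n)"
    and k: "card (relevant_primes (dirichlet_mult g h)) = k"
    and q: "q > 0"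
    and t: "real_of_int t > real n / real p *
           ln (real n * real q * real_of_int (dp_height (dirichlet_mult g h)) / real p *
               (real n / 2) powr (real k * (1 + log 3 (log 2 12) / 2)))"
  shows "t > 0 \<and> int q < \<bar>dp_value g (nat t)\<bar>"
proof -
  have nonconst: "\<exists>j\<ge>2. f j \<noteq> 0" if f: "dirichlet_poly f" "\<not> dp_constant f" for f
  proof -
    obtain j where j: "f j \<noteq> 0" "j \<noteq> 1"
      using f(2) by (auto simp: dp_constant_def)
    then have "j \<ge> 2" using dirichlet_poly_gt_0[OF f(1) j(1)] by linarith
    with j show ?thesis by blast
  qed
  obtain j where j: "j \<ge> 2" "g j \<noteq> 0" using nonconst[OF gh(1) nc(1)] by blast
  obtain l where l: "l \<ge> 2" "h l \<noteq> 0" using nonconst[OF gh(2) nc(2)] by blast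
  define f where "f = dirichlet_mult g h"
  define m where "m = dp_degree g"
  define m' where "m' = dp_degree h"
  have m: "m \<ge> 2" "m' \<ge> 2"
    using dp_degree_ge[OF gh(1) j(2)] dp_degree_ge[OF gh(2) l(2)] j l by (auto simp: m_def m'_def)
  have nm: "n = m * m'"
    using dp_degree_mult[OF gh j(2) l(2)] n by (simp add: m_def m'_def)
  have n4: "n \<ge> 4"
    using mult_le_mono[OF m] nm by simp
  have "prime_factors n \<noteq> {}"
    using n4 by (simp add: prime_factorization_empty_iff)
  then have "p \<in> prime_factors n"
    unfolding p by (intro Min_in) auto
  then have p_prime: "prime p" by auto
  \<comment> \<open>Every prime factor of the cofactor degree \<open>m'\<close> divides
    \<open>n\<close>; hence \<open>m = n / m'\<close> is at most \<open>n / p\<close>, the factor in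
    the bound on \<open>t\<close>.\<close>
  have "p \<le> m'"
  proof -
    obtain r where r: "prime r" "r dvd m'" using m prime_factor_nat[of m'] by auto
    then have "r \<in> prime_factors n" using m nm by (intro prime_factorsI) auto
    then have "p \<le> r" unfolding p by (intro Min_le) auto
    also have "r \<le> m'" using r m by (intro dvd_imp_le) auto
    finally show ?thesis .
  qed
  then have "m * p \<le> n" unfolding nm by simp
  then have M: "real m \<le> real n / real p"
    using of_nat_mono[of "m * p" n, where 'a = real] prime_gt_0_nat[OF p_prime] by (simp add: field_simps)

  let ?e = "real k * (1 + log 3 (log 2 12) / 2)"
  let ?C = "real_of_int (dp_height f) * (real n / 2) powr ?e"
  obtain i where i: "g i \<noteq> 0" "dp_height g = \<bar>g i\<bar>"
    using dp_height_attained[OF gh(1) j(2)] .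
  have Hg: "1 \<le> dp_height g" using i by linarith
  have Hf: "0 \<le> dp_height f"
  proof -
    have "f n \<noteq> 0"
    proof -
      have "dirichlet_mult g h (m * m') = g m * h m'"
        unfolding m_def m'_def
        by (rule dirichlet_mult_dp_degree[OF gh j(2) l(2)])
      then show ?thesis
        using dp_degree_coeff[OF gh(1) j(2)] dp_degree_coeff[OF gh(2) l(2)]
        by (simp add: f_def nm m_def m'_def)
    qed
    moreover have "dirichlet_poly f"
      unfolding f_def by (rule dirichlet_poly_mult[OF gh])
    ultimately show ?thesis
      using abs_le_dp_height[of f n] by linarith
  qed
  have HgC: "real_of_int (dp_height g) \<le> ?C"
  proof -
    \<comment> \<open>Since \<open>12 \<ge> 2 ^ 3\<close>, the inner logarithm is at least 3 and the
      outer at least 1, so the exponent \<open>?e\<close> is at least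
      \<open>3 * k / 2\<close>.\<close>
    have log12: "log 2 12 \<ge> (3 :: real)"
      by (simp add: le_log_iff)
    then have "log 3 (log 2 12) \<ge> (1 :: real)"
      by (simp add: le_log_iff)
    then have "real k * 1 \<le> real k * log 3 (log 2 12)"
      by (intro mult_left_mono) auto
    then have "real (3 * k) \<le> 2 * ?e"
      by (simp add: algebra_simps)
    then have "(real n / 2) powr real (3 * k) \<le> (real n / 2) powr (2 * ?e)"
      using n4 by (intro powr_mono) auto
    then have pow: "(real n / 2) ^ (3 * k) \<le> ((real n / 2) powr ?e)\<^sup>2"
      using n4 by (simp only: powr_realpow) (simp add: powr_realpow powr_power mult.commute)
    have "(real_of_int (dp_height g))\<^sup>2 = (real_of_int (g i))\<^sup>2"
      using i by simp
    also have "\<dots> \<le> (real_of_int (dp_height f))\<^sup>2 * (real n / 2) ^ (3 * k)"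
      using factor_coeff_bound[OF gh i(1) l(2) n n4 k] by (simp add: f_def)
    also have "\<dots> \<le> (real_of_int (dp_height f))\<^sup>2 * ((real n / 2) powr ?e)\<^sup>2"
      using pow by (intro mult_left_mono) auto
    also have "\<dots> = ?C\<^sup>2" by (simp add: power_mult_distrib)
    finally show ?thesis
      by (rule power2_le_imp_le) (use Hf in simp)
  qed

  \<comment> \<open>\<open>?c\<close> is at most the argument of the logarithm in the hypothesis on
    \<open>t\<close>; being above 1, it also forces \<open>t > 0\<close>.\<close>
  let ?c = "real m * real q * real_of_int (dp_height g)"
  have c1: "1 < ?c"
  proof -
    have "2 * 1 * 1 \<le> ?c" using m q Hg by (intro mult_mono) auto
    then show ?thesis by simp
  qed
  have "?c \<le> (real n / real p) * real q * ?C"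
    using M HgC Hg by (intro mult_mono) auto
  also have "\<dots> = real n * real q * real_of_int (dp_height f) / real p * (real n / 2) powr ?e"
    by simp
  finally have "ln ?c \<le> ln (real n * real q * real_of_int (dp_height f) / real p * (real n / 2) powr ?e)"
    using c1 by (subst ln_le_cancel_iff) auto
  then have "real n / real p * ln ?c \<le>
      real n / real p * ln (real n * real q * real_of_int (dp_height f) / real p * (real n / 2) powr ?e)"
    by (intro mult_left_mono) auto
  then have tc: "real n / real p * ln ?c < real_of_int t"
    using t unfolding f_def by linarith
  moreover have "0 \<le> real n / real p * ln ?c"
    using c1 by (intro mult_nonneg_nonneg) auto
  ultimately have t0: "t > 0" by linarith
  obtain d where d: "m = Suc d" "d > 0" using m by (cases m) auto
  let ?T = "nat t"
  have "?c * real d ^ ?T < real (Suc d) ^ ?T"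
    using tc M c1 t0 d by (intro power_ratio_gt[of d "real n / real p"]) auto
  then have "real_of_int (int m * int q * dp_height g * int d ^ ?T) < real_of_int (int (Suc d) ^ ?T)"
    by simp
  then have lt: "int (Suc d) * int q * dp_height g * int d ^ ?T < int (Suc d) ^ ?T"
    unfolding of_int_less_iff d(1) .
  \<comment> \<open>The difference of the two sides is \<open>(q - 1) * H * d + q * (H - 1)\<close>
    with \<open>H\<close> the height of \<open>g\<close>. This margin pays for the lower terms and
    leaves an excess of \<open>q\<close>.\<close>
  have "dp_height g * int d + int q \<le> int (Suc d) * int q * dp_height g"
  proof -
    have "0 \<le> (int q - 1) * (dp_height g * int d) + int q * (dp_height g - 1)"
      using q Hg by (intro add_nonneg_nonneg mult_nonneg_nonneg) auto
    then show ?thesis by (simp add: algebra_simps)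
  qed
  then have "(dp_height g * int d + int q) * int d ^ ?T \<le> int (Suc d) * int q * dp_height g * int d ^ ?T"
    by (intro mult_right_mono) auto
  with lt have "dp_height g * (int d * int d ^ ?T) + int q * int d ^ ?T < int (Suc d) ^ ?T"
    by (simp add: algebra_simps)
  moreover have "int q * 1 \<le> int q * int d ^ ?T"
    using d by (intro mult_left_mono one_le_power) auto
  moreover have "dp_degree g = Suc d" using d m_def by simp
  ultimately have "int q < \<bar>dp_value g ?T\<bar>"
    using dp_value_ge[OF gh(1) j(2), of d ?T] by linarith
  with t0 show ?thesis by blast
qed

section \<open>From lower bounds on both factors to irreducibility\<close>

theorem theorem6p2:
  fixes f :: "nat \<Rightarrow> int" and n p k P q :: nat and t :: int
  assumes "dirichlet_poly f"
    and "dp_degree f = n"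
    and "n > 1" and "\<not> prime n"
    and "p = Min (prime_factors n)"
    and "card (relevant_primes f) = k" and "k \<ge> 1"
    and "\<bar>dp_eval f (- real_of_int t)\<bar> = real (P * q)"
    and "prime P" and "q > 0"
    and "real_of_int t > real n / real p *
           ln (real n * real q * real_of_int (dp_height f) / real p *
               (real n / 2) powr (real k * (1 + log 3 (log 2 12) / 2)))"
  shows "dp_irreducible f"
  unfolding dp_irreducible_def
proof
  assume "\<exists>g h. dirichlet_poly g \<and> dirichlet_poly h \<and>
      \<not> dp_constant g \<and> \<not> dp_constant h \<and> f = dirichlet_mult g h"
  then obtain g h where gh: "dirichlet_poly g" "dirichlet_poly h"
    and nc: "\<not> dp_constant g" "\<not> dp_constant h" and f: "f = dirichlet_mult g h"
    by blast
  have f': "f = dirichlet_mult h g"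
    unfolding f by (rule dirichlet_mult_commute)
  let ?T = "nat t"
  have t: "t > 0" and g_gt: "int q < \<bar>dp_value g ?T\<bar>"
    using factor_value_gt[OF gh nc assms(2)[unfolded f] assms(5) assms(6)[unfolded f] assms(10)
        assms(11)[unfolded f]] by auto
  have h_gt: "int q < \<bar>dp_value h ?T\<bar>"
    using factor_value_gt[OF gh(2,1) nc(2,1) assms(2)[unfolded f'] assms(5) assms(6)[unfolded f']
        assms(10) assms(11)[unfolded f']] by auto
  \<comment> \<open>As \<open>t\<close> is positive, \<open>nat t\<close> loses nothing, and the
    hypothesis on the real value becomes an equation between integers.\<close>
  have "real_of_int t = real ?T" using t by simp
  then have "dp_eval f (- real_of_int t) = real_of_int (dp_value f ?T)"
    using dp_eval_eq_dp_value[OF assms(1), of ?T] by (simp only:)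
  then have "real_of_int \<bar>dp_value f ?T\<bar> = real_of_int (int (P * q))"
    using assms(8) by simp
  then have "\<bar>dp_value f ?T\<bar> = int (P * q)"
    by (simp only: of_int_eq_iff)
  then have prod: "\<bar>dp_value g ?T\<bar> * \<bar>dp_value h ?T\<bar> = int P * int q"
    by (simp add: f dp_value_mult[OF gh] abs_mult)
  have small: "y \<le> int q" if xy: "int P dvd x" "x * y = int P * int q" "y \<ge> 0" for x y :: int
  proof -
    obtain c where c: "x = int P * c" using xy(1) by blast
    then have cy: "c * y = int q"
      using xy(2) prime_gt_0_nat[OF assms(9)] by simp
    have "c > 0"
      using mult_nonpos_nonneg[of c y] cy xy(3) assms(10) by linarith
    then have "1 * y \<le> c * y" using xy(3) by (intro mult_right_mono) auto
    then show ?thesis using cy by simp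
  qed
  have "int P dvd \<bar>dp_value g ?T\<bar> \<or> int P dvd \<bar>dp_value h ?T\<bar>"
    using assms(9) prod by (intro prime_dvd_multD) auto
  then show False
  proof
    assume "int P dvd \<bar>dp_value g ?T\<bar>"
    from small[OF this prod] h_gt show False by simp
  next
    assume "int P dvd \<bar>dp_value h ?T\<bar>"
    moreover have "\<bar>dp_value h ?T\<bar> * \<bar>dp_value g ?T\<bar> = int P * int q"
      using prod by (simp only: mult.commute)
    ultimately show False using small[of "\<bar>dp_value h ?T\<bar>" "\<bar>dp_value g ?T\<bar>"] g_gt by simp
  qed
qed

end
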